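(* Suppose that $\mathcal{A}$ and $\mathcal{B}$ are computable $(1,2)$-equivalence structures, each having generic character $\{2\}$. Then $\mathcal{A}$ is generically computably isomorphic to a computable structure in which the set of elements of size $2$ (elements whose equivalence class has exactly two elements) is computable, and therefore $\mathcal{A}$ and $\mathcal{B}$ are generically computably isomorphic.
   Context: Structures have universe $\omega$. An equivalence structure is computable if its equivalence relation is computable. A $(1,2)$-structure is an equivalence structure consisting of infinitely many classes of size 1 and infinitely many classes of size 2 (and no other classes). $\mathcal{A}(k)$ denotes the set of elements of $\mathcal{A}$ whose equivalence class has size $k$. A set $S\subseteq\omega$ has asymptotic density $\delta$ if $\lim_{n\to\infty} |S\cap\{0,\dots,n\}|/(n+1)=\delta$. $\mathcal{A}$ has generic character $\{k\}$ if $\mathcal{A}(k)$ has asymptotic density one. Two structures $\mathcal{A}$ and $\mathcal{B}$ are generically computably isomorphic if there are an isomorphism $f:\mathcal{A}\to\mathcal{B}$ and a partial computable function $\theta$ such that both the domain and the range of $\theta$ have asymptotic density one, and $\theta(x)=f(x)$ whenever $\theta(x)$ is defined. *)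

theory Defs
  imports Complex_Main
begin

section \<open>Partial computable functions\<close>

text \<open>
  Kleene's mu-recursive functions, as programs acting on argument lists; the result
  \<open>None\<close> means that the program diverges (or is applied to the wrong number of arguments).
  In \<open>Prec\<close> and \<open>Mu\<close> the recursion, resp. search, variable is the first argument, and the
  step function of \<open>Prec\<close> receives the previous value before the recursion variable.
\<close>

datatype recf =
    Zero
  | Succ
  | Proj nat
  | Comp recf "recf list"
  | Prec recf recf
  | Mu recf

fun rec_eval :: "recf \<Rightarrow> nat list \<Rightarrow> nat option" where
  "rec_eval Zero xs = Some 0"
| "rec_eval Succ xs = (case xs of [x] \<Rightarrow> Some (Suc x) | _ \<Rightarrow> None)"
| "rec_eval (Proj i) xs = (if i < length xs then Some (xs ! i) else None)"
| "rec_eval (Comp f gs) xs =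
     Option.bind (those (map (\<lambda>g. rec_eval g xs) gs)) (\<lambda>ys. rec_eval f ys)"
| "rec_eval (Prec f g) xs =
     (case xs of
        [] \<Rightarrow> None
      | n # ys \<Rightarrow>
          rec_nat (rec_eval f ys) (\<lambda>m r. Option.bind r (\<lambda>v. rec_eval g (v # m # ys))) n)"
| "rec_eval (Mu f) xs =
     (if \<exists>n. rec_eval f (n # xs) = Some 0 \<and> (\<forall>i<n. rec_eval f (i # xs) \<noteq> None)
      then Some (LEAST n. rec_eval f (n # xs) = Some 0)
      else None)"

definition partial_computable :: "(nat \<rightharpoonup> nat) \<Rightarrow> bool" where
  "partial_computable \<theta> \<longleftrightarrow> (\<exists>p. \<forall>x. rec_eval p [x] = \<theta> x)"

definition computable_set :: "nat set \<Rightarrow> bool" where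
  "computable_set S \<longleftrightarrow> (\<exists>p. \<forall>x. rec_eval p [x] = Some (if x \<in> S then 1 else 0))"

definition computable_rel :: "nat rel \<Rightarrow> bool" where
  "computable_rel R \<longleftrightarrow>
     (\<exists>p. \<forall>x y. rec_eval p [x, y] = Some (if (x, y) \<in> R then 1 else 0))"

section \<open>Equivalence structures with universe the natural numbers\<close>

text \<open>A structure is identified with its equivalence relation on \<open>UNIV :: nat set\<close>.\<close>

definition computable_equivalence_structure :: "nat rel \<Rightarrow> bool" where
  "computable_equivalence_structure E \<longleftrightarrow> equiv UNIV E \<and> computable_rel E"

definition one_two_structure :: "nat rel \<Rightarrow> bool" where
  "one_two_structure E \<longleftrightarrow>
     equiv UNIV E \<and>
     infinite {c \<in> UNIV // E. card c = 1} \<and>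
     infinite {c \<in> UNIV // E. card c = 2} \<and>
     (\<forall>c \<in> UNIV // E. card c = 1 \<or> card c = 2)"

definition elements_of_size :: "nat rel \<Rightarrow> nat \<Rightarrow> nat set" where
  "elements_of_size E k = {x. finite (E `` {x}) \<and> card (E `` {x}) = k}"

definition has_density :: "nat set \<Rightarrow> real \<Rightarrow> bool" where
  "has_density S \<delta> \<longleftrightarrow>
     (\<lambda>n. real (card (S \<inter> {0..n})) / real (n + 1)) \<longlonglongrightarrow> \<delta>"

text \<open>The generic character \<open>{k}\<close>.\<close>

definition has_generic_character_singleton :: "nat rel \<Rightarrow> nat \<Rightarrow> bool" where
  "has_generic_character_singleton E k \<longleftrightarrow> has_density (elements_of_size E k) 1"

definition structure_isomorphism :: "nat rel \<Rightarrow> nat rel \<Rightarrow> (nat \<Rightarrow> nat) \<Rightarrow> bool" where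
  "structure_isomorphism A B f \<longleftrightarrow>
     bij f \<and> (\<forall>x y. (x, y) \<in> A \<longleftrightarrow> (f x, f y) \<in> B)"

definition generically_computably_isomorphic :: "nat rel \<Rightarrow> nat rel \<Rightarrow> bool" where
  "generically_computably_isomorphic A B \<longleftrightarrow>
     (\<exists>f \<theta>. structure_isomorphism A B f \<and> partial_computable \<theta> \<and>
        has_density (dom \<theta>) 1 \<and> has_density (ran \<theta>) 1 \<and>
        (\<forall>x \<in> dom \<theta>. \<theta> x = Some (f x)))"

end

theory Submission
  imports Defs "HOL-Library.Infinite_Set" "HOL-Real_Asymp.Real_Asymp"
begin

text \<open>
  In a computable structure with classes of size 1 and 2 only, every two-element class is
  recognised at its larger element: the set of larger elements of two-element classes is
  decidable, because membership of \<open>s\<close> only asks for some \<open>y < s\<close> equivalent to \<open>s\<close>.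
  Thus the \<open>i\<close>-th larger element of one structure can be computed from the \<open>i\<close>-th larger element
  of the other, and this matching of two-element classes extends to the smaller elements.
  Given \<open>x\<close>, an unbounded search for another element of its class halts exactly when
  the class of \<open>x\<close> has size 2; hence the matching is a partial computable function \<open>\<theta>\<close> whose
  domain and range are precisely the sets of elements of size 2 of the two structures. These sets
  have density one by hypothesis, and an arbitrary bijection between the infinite sets of
  elements of size 1 turns \<open>\<theta>\<close> into an isomorphism (\<open>generically_isomorphic_if_dense_pairs\<close>).

  So any two computable structures of the given kind are generically computably isomorphic, and it
  remains to exhibit one whose elements of size 2 form a computable set. The non-squares form a
  computable set of density one; pairing its \<open>2k\<close>-th with its \<open>(2k+1)\<close>-st element and
  leaving the squares alone gives the structure (\<open>paired_structure\<close>).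

  The effectivity claims rest on closure properties of the functions computed by programs. They
  are phrased for functions of an argument list of fixed length, and their conclusions are
  higher-order patterns, so that a function written in ordinary notation is shown to be
  computable by resolution with the closure rules.
\<close>

section \<open>Closure properties of computable functions and decidable predicates\<close>

definition recursive :: "nat \<Rightarrow> (nat list \<Rightarrow> nat) \<Rightarrow> bool" where
  "recursive n f \<longleftrightarrow> (\<exists>p. \<forall>xs. length xs = n \<longrightarrow> rec_eval p xs = Some (f xs))"

definition decidable :: "nat \<Rightarrow> (nat list \<Rightarrow> bool) \<Rightarrow> bool" where
  "decidable n P \<longleftrightarrow> recursive n (\<lambda>xs. of_bool (P xs))"

lemma recursive_cong:
  assumes "recursive n f" and "\<And>xs. length xs = n \<Longrightarrow> f xs = g xs"
  shows "recursive n g"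
  using assms unfolding recursive_def by metis

lemma decidable_cong:
  assumes "decidable n P" and "\<And>xs. length xs = n \<Longrightarrow> P xs = Q xs"
  shows "decidable n Q"
  using assms(1) unfolding decidable_def
  by (rule recursive_cong) (simp add: assms(2))

lemma those_map_Some: "those (map (\<lambda>x. Some (h x)) xs) = Some (map h xs)"
  by (induction xs) auto

lemma those_map_eq_Some:
  assumes "\<And>x. x \<in> set xs \<Longrightarrow> f x = Some (h x)"
  shows "those (map f xs) = Some (map h xs)"
proof -
  have "map f xs = map (\<lambda>x. Some (h x)) xs"
    using assms by simp
  then show ?thesis
    by (simp only: those_map_Some)
qed

lemma those_projections:
  assumes "b \<le> length xs"
  shows "those (map (\<lambda>g. rec_eval g xs) (map Proj [a..<b])) = Some (map (nth xs) [a..<b])"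
proof -
  have "those (map (\<lambda>i. rec_eval (Proj i) xs) [a..<b]) = Some (map (nth xs) [a..<b])"
    by (rule those_map_eq_Some) (use assms in auto)
  then show ?thesis
    by (simp add: comp_def)
qed

lemma recursive_tl:
  assumes "recursive n f"
  shows "recursive (Suc n) (\<lambda>xs. f (tl xs))"
proof -
  obtain p where p: "\<And>xs. length xs = n \<Longrightarrow> rec_eval p xs = Some (f xs)"
    using assms unfolding recursive_def by blast
  have "rec_eval (Comp p (map Proj [1..<Suc n])) xs = Some (f (tl xs))"
    if "length xs = Suc n" for xs
  proof -
    have "map (nth xs) [1..<Suc n] = tl xs"
      using that by (intro nth_equalityI) (auto simp: nth_tl simp del: upt_Suc)
    then show ?thesis
      using that p[of "tl xs"] those_projections[of "Suc n" xs 1]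
      by (simp del: upt_Suc map_map)
  qed
  then show ?thesis
    unfolding recursive_def by blast
qed

lemma recursive_nth: "i < n \<Longrightarrow> recursive n (\<lambda>xs. xs ! i)"
  unfolding recursive_def by (intro exI[of _ "Proj i"]) simp

lemma recursive_nth_tl: "Suc i < n \<Longrightarrow> recursive n (\<lambda>xs. tl xs ! i)"
  by (cases n) (auto intro: recursive_tl recursive_nth)

lemma recursive_compose1:
  assumes "recursive 1 (\<lambda>xs. F (xs ! 0))" "recursive n f"
  shows "recursive n (\<lambda>xs. F (f xs))"
proof -
  obtain p q where "\<And>xs. length xs = 1 \<Longrightarrow> rec_eval p xs = Some (F (xs ! 0))"
    and "\<And>xs. length xs = n \<Longrightarrow> rec_eval q xs = Some (f xs)"
    using assms unfolding recursive_def by metis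
  then show ?thesis
    unfolding recursive_def by (intro exI[of _ "Comp p [q]"]) simp
qed

lemma recursive_compose2:
  assumes "recursive 2 (\<lambda>xs. F (xs ! 0) (xs ! 1))" "recursive n f" "recursive n g"
  shows "recursive n (\<lambda>xs. F (f xs) (g xs))"
proof -
  obtain p q r where "\<And>xs. length xs = 2 \<Longrightarrow> rec_eval p xs = Some (F (xs ! 0) (xs ! 1))"
    and "\<And>xs. length xs = n \<Longrightarrow> rec_eval q xs = Some (f xs)"
    and "\<And>xs. length xs = n \<Longrightarrow> rec_eval r xs = Some (g xs)"
    using assms unfolding recursive_def by metis
  then show ?thesis
    unfolding recursive_def by (intro exI[of _ "Comp p [q, r]"]) simp
qed

lemma recursive_Suc:
  assumes "recursive n f"
  shows "recursive n (\<lambda>xs. Suc (f xs))"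
proof (rule recursive_compose1[OF _ assms])
  show "recursive 1 (\<lambda>xs. Suc (xs ! 0))"
    unfolding recursive_def by (intro exI[of _ Succ]) (auto simp: length_Suc_conv)
qed

lemma recursive_const: "recursive n (\<lambda>_. c)"
proof (induction c)
  case 0
  show ?case
    unfolding recursive_def by (intro exI[of _ Zero]) simp
next
  case (Suc c)
  then show ?case
    by (rule recursive_Suc)
qed

text \<open>
  Source of all the arithmetic below. The program \<open>Prec\<close> recurses on its first argument and
  passes the others along, so the parameters \<open>xs\<close> are copied by projections and preceded by
  the value \<open>h xs\<close> at which the recursion is to be evaluated.
\<close>

lemma recursive_rec_nat:
  assumes "recursive n f"
    and "recursive (Suc (Suc n)) (\<lambda>zs. g (zs ! 1) (zs ! 0) (tl (tl zs)))"
    and "recursive n h"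
  shows "recursive n (\<lambda>xs. rec_nat (f xs) (\<lambda>m r. g m r xs) (h xs))"
proof -
  obtain p where p: "\<And>xs. length xs = n \<Longrightarrow> rec_eval p xs = Some (f xs)"
    using assms(1) unfolding recursive_def by blast
  obtain q where q: "\<And>zs. length zs = Suc (Suc n) \<Longrightarrow>
      rec_eval q zs = Some (g (zs ! 1) (zs ! 0) (tl (tl zs)))"
    using assms(2) unfolding recursive_def by blast
  obtain r where r: "\<And>xs. length xs = n \<Longrightarrow> rec_eval r xs = Some (h xs)"
    using assms(3) unfolding recursive_def by blast
  have "rec_eval (Comp (Prec p q) (r # map Proj [0..<n])) xs =
      Some (rec_nat (f xs) (\<lambda>m r. g m r xs) (h xs))" if "length xs = n" for xs
  proof -
    have "map (nth xs) [0..<n] = xs"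
      using that map_nth by blast
    then have args: "those (map (\<lambda>g. rec_eval g xs) (map Proj [0..<n])) = Some xs"
      using that those_projections[of n xs 0] by simp
    have "rec_nat (rec_eval p xs) (\<lambda>m r. Option.bind r (\<lambda>v. rec_eval q (v # m # xs))) k =
        Some (rec_nat (f xs) (\<lambda>m r. g m r xs) k)" for k
      using that p q by (induction k) auto
    then show ?thesis
      using that r args by (simp del: map_map)
  qed
  then show ?thesis
    unfolding recursive_def by blast
qed

lemma recursive_add:
  assumes "recursive n f" "recursive n g"
  shows "recursive n (\<lambda>xs. f xs + g xs)"
proof -
  have "recursive n (\<lambda>xs. rec_nat (f xs) (\<lambda>_ r. Suc r) (g xs))"
    by (rule recursive_rec_nat) (auto intro: assms recursive_Suc recursive_nth)
  moreover have "rec_nat a (\<lambda>_ r. Suc r) b = a + b" for a b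
    by (induction b) auto
  ultimately show ?thesis
    by simp
qed

lemma recursive_pred:
  assumes "recursive n f"
  shows "recursive n (\<lambda>xs. f xs - 1)"
proof -
  have "recursive n (\<lambda>xs. rec_nat 0 (\<lambda>m _. m) (f xs))"
    by (rule recursive_rec_nat) (auto intro: assms recursive_const recursive_nth)
  moreover have "rec_nat 0 (\<lambda>m _. m) a = a - 1" for a
    by (cases a) auto
  ultimately show ?thesis
    by simp
qed

lemma recursive_diff:
  assumes "recursive n f" "recursive n g"
  shows "recursive n (\<lambda>xs. f xs - g xs)"
proof -
  have "recursive n (\<lambda>xs. rec_nat (f xs) (\<lambda>_ r. r - 1) (g xs))"
    by (rule recursive_rec_nat) (auto intro!: assms recursive_pred[unfolded One_nat_def] recursive_nth)
  moreover have "rec_nat a (\<lambda>_ r. r - 1) b = a - b" for a b :: nat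
    by (induction b) auto
  ultimately show ?thesis
    by simp
qed

lemma recursive_mult:
  assumes "recursive n f" "recursive n g"
  shows "recursive n (\<lambda>xs. f xs * g xs)"
proof -
  have "recursive n (\<lambda>xs. rec_nat 0 (\<lambda>_ r. r + f xs) (g xs))"
    by (rule recursive_rec_nat)
      (auto intro!: assms recursive_add recursive_const recursive_nth
        recursive_tl[OF recursive_tl[OF assms(1)]])
  moreover have "rec_nat 0 (\<lambda>_ r. r + a) b = a * b" for a b :: nat
    by (induction b) auto
  ultimately show ?thesis
    by simp
qed

lemma decidable_le:
  assumes "recursive n f" "recursive n g"
  shows "decidable n (\<lambda>xs. f xs \<le> g xs)"
proof -
  have "recursive n (\<lambda>xs. 1 - (f xs - g xs))"
    by (intro assms recursive_diff recursive_const)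
  then show ?thesis
    unfolding decidable_def by (rule recursive_cong) (simp add: of_bool_def)
qed

lemma decidable_not:
  assumes "decidable n P"
  shows "decidable n (\<lambda>xs. \<not> P xs)"
proof -
  have "recursive n (\<lambda>xs. 1 - of_bool (P xs))"
    using assms unfolding decidable_def by (intro recursive_diff recursive_const)
  then show ?thesis
    unfolding decidable_def by (rule recursive_cong) simp
qed

lemma decidable_conj:
  assumes "decidable n P" "decidable n Q"
  shows "decidable n (\<lambda>xs. P xs \<and> Q xs)"
  using recursive_mult[of n "\<lambda>xs. of_bool (P xs)" "\<lambda>xs. of_bool (Q xs)"] assms
  unfolding decidable_def by (simp add: of_bool_conj)

lemma decidable_disj:
  assumes "decidable n P" "decidable n Q"
  shows "decidable n (\<lambda>xs. P xs \<or> Q xs)"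
proof -
  have "decidable n (\<lambda>xs. \<not> (\<not> P xs \<and> \<not> Q xs))"
    by (intro assms decidable_not decidable_conj)
  then show ?thesis
    by simp
qed

lemma decidable_less:
  assumes "recursive n f" "recursive n g"
  shows "decidable n (\<lambda>xs. f xs < g xs)"
  using decidable_not[OF decidable_le[OF assms(2,1)]] by (simp add: not_le)

lemma decidable_eq:
  assumes "recursive n f" "recursive n g"
  shows "decidable n (\<lambda>xs. f xs = g xs)"
  using decidable_conj[OF decidable_le[OF assms] decidable_le[OF assms(2,1)]]
  by (simp add: eq_iff)

lemma recursive_If:
  assumes "decidable n P" "recursive n f" "recursive n g"
  shows "recursive n (\<lambda>xs. if P xs then f xs else g xs)"
proof -
  have "recursive n (\<lambda>xs. of_bool (P xs) * f xs + of_bool (\<not> P xs) * g xs)"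
    using assms decidable_not[OF assms(1)] unfolding decidable_def
    by (intro recursive_add recursive_mult)
  then show ?thesis
    by (rule recursive_cong) simp
qed

text \<open>
  Bounded counting serves twice: it makes bounded quantifiers decidable, and it computes the position
  of a number in a decidable set.
\<close>

lemma recursive_count:
  assumes "decidable (Suc n) (\<lambda>zs. P (zs ! 0) (tl zs))" "recursive n h"
  shows "recursive n (\<lambda>xs. card {i. i < h xs \<and> P i xs})"
proof -
  have "recursive (Suc (Suc n)) (\<lambda>zs. of_bool (P (zs ! 1) (tl (tl zs))))"
    using recursive_tl[OF assms(1)[unfolded decidable_def]]
    by (rule recursive_cong) (simp add: nth_tl)
  then have "recursive n (\<lambda>xs. rec_nat 0 (\<lambda>m r. r + of_bool (P m xs)) (h xs))"
    by (intro recursive_rec_nat recursive_add recursive_const recursive_nth assms(2)) auto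
  moreover have "rec_nat 0 (\<lambda>m r. r + of_bool (P m xs)) k = card {i. i < k \<and> P i xs}" for k xs
  proof (induction k)
    case (Suc k)
    have "{i. i < Suc k \<and> P i xs} = {i. i < k \<and> P i xs} \<union> (if P k xs then {k} else {})"
      by (auto simp: less_Suc_eq)
    then show ?case
      using Suc by simp
  qed simp
  ultimately show ?thesis
    by simp
qed

lemma decidable_bex:
  assumes "decidable (Suc n) (\<lambda>zs. P (zs ! 0) (tl zs))" "recursive n h"
  shows "decidable n (\<lambda>xs. \<exists>i<h xs. P i xs)"
proof -
  have "decidable n (\<lambda>xs. 0 < card {i. i < h xs \<and> P i xs})"
    by (intro decidable_less recursive_const recursive_count assms)
  then show ?thesis
    by (rule decidable_cong) (auto simp: card_gt_0_iff)
qed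

text \<open>
  The program \<open>Mu\<close> searches for a zero, so it is applied to the decision procedure for the
  negated predicate. That procedure is total, which makes the convergence condition in the
  semantics of \<open>Mu\<close> vacuous.
\<close>

lemma decidable_search:
  assumes "decidable (Suc n) (\<lambda>zs. P (zs ! 0) (tl zs))"
  obtains p where "\<And>xs. length xs = n \<Longrightarrow>
    rec_eval p xs = (if \<exists>m. P m xs then Some (LEAST m. P m xs) else None)"
proof -
  obtain p where p: "\<And>zs. length zs = Suc n \<Longrightarrow>
      rec_eval p zs = Some (of_bool (\<not> P (zs ! 0) (tl zs)))"
    using decidable_not[OF assms] unfolding decidable_def recursive_def by blast
  have "rec_eval (Mu p) xs = (if \<exists>m. P m xs then Some (LEAST m. P m xs) else None)"
    if "length xs = n" for xs
    using that p by simp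
  then show ?thesis
    by (rule that)
qed

lemma recursive_Least:
  assumes "decidable (Suc n) (\<lambda>zs. P (zs ! 0) (tl zs))"
    and "\<And>xs. length xs = n \<Longrightarrow> \<exists>m. P m xs"
  shows "recursive n (\<lambda>xs. LEAST m. P m xs)"
proof -
  obtain p where "\<And>xs. length xs = n \<Longrightarrow>
      rec_eval p xs = (if \<exists>m. P m xs then Some (LEAST m. P m xs) else None)"
    using decidable_search[OF assms(1)] by blast
  then show ?thesis
    unfolding recursive_def using assms(2) by (intro exI[of _ p]) auto
qed

lemma partial_computable_search:
  assumes "decidable 2 (\<lambda>zs. P (zs ! 1) (zs ! 0))"
    and "recursive 2 (\<lambda>zs. F (zs ! 0) (zs ! 1))"
  shows "partial_computable (\<lambda>x. if \<exists>y. P x y then Some (F x (LEAST y. P x y)) else None)"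
proof -
  have "decidable (Suc 1) (\<lambda>zs. P (tl zs ! 0) (zs ! 0))"
    using assms(1) unfolding Suc_1 by (rule decidable_cong) (simp add: nth_tl)
  then obtain p where p: "\<And>xs. length xs = 1 \<Longrightarrow>
      rec_eval p xs = (if \<exists>y. P (xs ! 0) y then Some (LEAST y. P (xs ! 0) y) else None)"
    using decidable_search[of 1 "\<lambda>y xs. P (xs ! 0) y"] by blast
  obtain q where q: "\<And>zs. length zs = 2 \<Longrightarrow> rec_eval q zs = Some (F (zs ! 0) (zs ! 1))"
    using assms(2) unfolding recursive_def by blast
  show ?thesis
    unfolding partial_computable_def
    by (intro exI[of _ "Comp q [Proj 0, p]"]) (simp add: p q)
qed

lemma computable_set_iff_decidable: "computable_set S \<longleftrightarrow> decidable 1 (\<lambda>xs. xs ! 0 \<in> S)"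
proof
  assume "computable_set S"
  then obtain p where "\<And>x. rec_eval p [x] = Some (if x \<in> S then 1 else 0)"
    unfolding computable_set_def by blast
  then show "decidable 1 (\<lambda>xs. xs ! 0 \<in> S)"
    unfolding decidable_def recursive_def of_bool_def
    by (intro exI[of _ p]) (auto simp: length_Suc_conv)
next
  assume "decidable 1 (\<lambda>xs. xs ! 0 \<in> S)"
  then show "computable_set S"
    unfolding computable_set_def decidable_def recursive_def of_bool_def
    by (metis length_Cons list.size(3) One_nat_def nth_Cons_0)
qed

lemma computable_rel_iff_decidable:
  "computable_rel R \<longleftrightarrow> decidable 2 (\<lambda>xs. (xs ! 0, xs ! 1) \<in> R)"
proof
  assume "computable_rel R"
  then obtain p where "\<And>x y. rec_eval p [x, y] = Some (if (x, y) \<in> R then 1 else 0)"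
    unfolding computable_rel_def by blast
  then show "decidable 2 (\<lambda>xs. (xs ! 0, xs ! 1) \<in> R)"
    unfolding decidable_def recursive_def of_bool_def
    by (intro exI[of _ p]) (auto simp: length_Suc_conv numeral_2_eq_2)
next
  assume "decidable 2 (\<lambda>xs. (xs ! 0, xs ! 1) \<in> R)"
  then obtain p where p: "\<And>xs. length xs = 2 \<Longrightarrow>
      rec_eval p xs = Some (of_bool ((xs ! 0, xs ! 1) \<in> R))"
    unfolding decidable_def recursive_def by blast
  show "computable_rel R"
    unfolding computable_rel_def
  proof (intro exI allI)
    fix x y
    show "rec_eval p [x, y] = Some (if (x, y) \<in> R then 1 else 0)"
      using p[of "[x, y]"] by (simp add: of_bool_def)
  qed
qed

lemma decidable_computable_set:
  assumes "computable_set S" "recursive n f"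
  shows "decidable n (\<lambda>xs. f xs \<in> S)"
  using recursive_compose1[OF _ assms(2), of "\<lambda>x. of_bool (x \<in> S)"] assms(1)
  unfolding computable_set_iff_decidable decidable_def by simp

lemma decidable_computable_rel:
  assumes "computable_rel R" "recursive n f" "recursive n g"
  shows "decidable n (\<lambda>xs. (f xs, g xs) \<in> R)"
  using recursive_compose2[OF _ assms(2,3), of "\<lambda>x y. of_bool ((x, y) \<in> R)"] assms(1)
  unfolding computable_rel_iff_decidable decidable_def by simp

lemmas computability_intros =
  recursive_nth recursive_nth_tl recursive_const recursive_Suc recursive_add
  recursive_mult recursive_If decidable_less decidable_eq decidable_not decidable_conj
  decidable_disj decidable_bex decidable_computable_set decidable_computable_rel

section \<open>Order isomorphisms between infinite sets of natural numbers\<close>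

definition rank :: "nat set \<Rightarrow> nat \<Rightarrow> nat" where
  "rank S x = card {i. i < x \<and> i \<in> S}"

lemma bij_betw_rank:
  assumes "infinite S"
  shows "bij_betw (rank S) S UNIV"
proof -
  have rank_less: "rank S x < rank S y" if "x \<in> S" "x < y" for x y
    unfolding rank_def using that by (intro psubset_card_mono) auto
  have "inj_on (rank S) S"
    by (rule linorder_inj_onI) (use rank_less in fastforce)+
  moreover have "\<exists>x\<in>S. rank S x = k" for k
  proof
    show "enumerate S k \<in> S"
      using assms by (rule enumerate_in_set)
    have "{i. i < enumerate S k \<and> i \<in> S} = enumerate S ` {..<k}"
    proof -
      have "i \<in> enumerate S ` {..<k}" if "i < enumerate S k" "i \<in> S" for i
      proof -
        obtain j where "i = enumerate S j"
          using \<open>i \<in> S\<close> range_enumerate[OF assms] by blast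
        then show ?thesis
          using that assms by (auto simp: enumerate_mono_iff)
      qed
      then show ?thesis
        using assms by (auto simp: enumerate_in_set enumerate_mono_iff)
    qed
    moreover have "inj_on (enumerate S) {..<k}"
      by (rule linorder_inj_onI) (use enumerate_mono[OF _ assms] in fastforce)+
    ultimately show "rank S (enumerate S k) = k"
      by (simp add: rank_def card_image)
  qed
  ultimately show ?thesis
    unfolding bij_betw_def by (metis UNIV_eq_I imageI)
qed

text \<open>
  The order isomorphism from \<open>S\<close> onto \<open>T\<close>, written as a search for the element of equal rank
  so that its computability can be read off.
\<close>

definition same_rank :: "nat set \<Rightarrow> nat set \<Rightarrow> nat \<Rightarrow> nat" where
  "same_rank S T x = (LEAST t. t \<in> T \<and> rank T t = rank S x)"

lemma ex_rank_eq:
  assumes "infinite T"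
  shows "\<exists>t. t \<in> T \<and> rank T t = k"
  using bij_betw_rank[OF assms] unfolding bij_betw_def by (metis UNIV_I imageE)

lemma same_rank:
  assumes "infinite T"
  shows "same_rank S T x \<in> T" "rank T (same_rank S T x) = rank S x"
  using LeastI_ex[OF ex_rank_eq[OF assms, of "rank S x"]] by (simp_all add: same_rank_def)

lemma same_rank_same_rank:
  assumes "infinite S" "infinite T" "x \<in> S"
  shows "same_rank T S (same_rank S T x) = x"
  using bij_betw_rank[OF assms(1)] same_rank[OF assms(1)] same_rank[OF assms(2)] assms(3)
  unfolding bij_betw_def by (metis inj_onD)

lemma bij_betw_same_rank:
  assumes "infinite S" "infinite T"
  shows "bij_betw (same_rank S T) S T"
  by (rule bij_betw_byWitness[where f' = "same_rank T S"])
    (auto simp: assms same_rank same_rank_same_rank)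

lemma recursive_rank:
  assumes "computable_set S" "recursive n f"
  shows "recursive n (\<lambda>xs. rank S (f xs))"
  unfolding rank_def by (intro recursive_count computability_intros assms) simp

lemma recursive_same_rank:
  assumes "computable_set S" "computable_set T" "infinite T" "recursive n f"
  shows "recursive n (\<lambda>xs. same_rank S T (f xs))"
  unfolding same_rank_def
proof (rule recursive_Least)
  show "decidable (Suc n) (\<lambda>zs. zs ! 0 \<in> T \<and> rank T (zs ! 0) = rank S (f (tl zs)))"
    using recursive_tl[OF assms(4)]
    by (intro computability_intros recursive_rank assms) auto
qed (rule ex_rank_eq[OF assms(3)])

section \<open>Matching the two-element classes\<close>

definition mate :: "nat rel \<Rightarrow> nat \<Rightarrow> nat" where
  "mate E x = (LEAST y. y \<noteq> x \<and> (x, y) \<in> E)"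

definition larger_elements :: "nat rel \<Rightarrow> nat set" where
  "larger_elements E = {s. \<exists>y<s. (y, s) \<in> E}"

text \<open>
  The dichotomy that justifies \<open>mate\<close>: its search finds the second element of the class if there
  is one. Facts about membership and relatedness below are read off from the two cases.
\<close>

lemma one_two_cases:
  assumes "one_two_structure E"
  obtains "E `` {x} = {x}" "x \<in> elements_of_size E 1" "x \<notin> elements_of_size E 2"
    "\<And>y. (x, y) \<in> E \<longleftrightarrow> y = x"
  | "E `` {x} = {x, mate E x}" "mate E x \<noteq> x" "x \<in> elements_of_size E 2"
    "x \<notin> elements_of_size E 1" "\<And>y. (x, y) \<in> E \<longleftrightarrow> y = x \<or> y = mate E x"
proof -
  have E: "equiv UNIV E" "card (E `` {x}) = 1 \<or> card (E `` {x}) = 2"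
    using assms by (auto simp: one_two_structure_def intro: quotientI)
  have x: "x \<in> E `` {x}"
    using equiv_class_self[OF E(1)] by blast
  show ?thesis
  proof (cases "card (E `` {x}) = 1")
    case True
    then have 1: "E `` {x} = {x}"
      using x by (metis card_1_singletonE singletonD)
    then have "(x, y) \<in> E \<longleftrightarrow> y = x" for y
      by blast
    then show ?thesis
      using that(1) 1 by (simp add: elements_of_size_def)
  next
    case False
    then obtain a b where "E `` {x} = {a, b}" "a \<noteq> b"
      using E(2) by (auto simp: card_2_iff)
    then obtain y where y: "y \<noteq> x" "E `` {x} = {x, y}"
      using x by (metis insert_commute insert_iff singletonD)
    then have "z \<noteq> x \<and> (x, z) \<in> E \<longleftrightarrow> z = y" for z
      by blast
    then have "mate E x = y"
      unfolding mate_def by (simp add: Least_equality)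
    moreover have "(x, z) \<in> E \<longleftrightarrow> z = x \<or> z = y" for z
      using y(2) by blast
    ultimately show ?thesis
      using that(2) y by (simp add: elements_of_size_def)
  qed
qed

lemma elements_of_size_1_eq:
  assumes "one_two_structure E"
  shows "elements_of_size E 1 = - elements_of_size E 2"
proof (intro set_eqI)
  show "x \<in> elements_of_size E 1 \<longleftrightarrow> x \<in> - elements_of_size E 2" for x
    by (rule one_two_cases[OF assms, of x]) auto
qed

lemma related_iff:
  assumes "one_two_structure E"
  shows "(x, y) \<in> E \<longleftrightarrow> y = x \<or> (x \<in> elements_of_size E 2 \<and> y = mate E x)"
  by (rule one_two_cases[OF assms, of x]) auto

lemma mem_elements_of_size_2_iff:
  assumes "one_two_structure E"
  shows "x \<in> elements_of_size E 2 \<longleftrightarrow> (\<exists>y. y \<noteq> x \<and> (x, y) \<in> E)"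
  by (rule one_two_cases[OF assms, of x]) auto

lemma mate_elements_of_size_2:
  assumes "one_two_structure E" "x \<in> elements_of_size E 2"
  shows "mate E x \<noteq> x" "mate E x \<in> elements_of_size E 2" "mate E (mate E x) = x"
proof -
  show ne: "mate E x \<noteq> x"
    by (rule one_two_cases[OF assms(1), of x]) (use assms(2) in auto)
  have "sym E"
    using assms(1) by (simp add: one_two_structure_def equiv_def)
  then have rel: "(mate E x, x) \<in> E"
    using related_iff[OF assms(1), of x "mate E x"] assms(2) by (simp add: symD)
  then show "mate E x \<in> elements_of_size E 2"
    using ne mem_elements_of_size_2_iff[OF assms(1)] by metis
  show "mate E (mate E x) = x"
    using rel ne related_iff[OF assms(1), of "mate E x" x] by simp
qed

lemma larger_elements_eq:
  assumes "one_two_structure E"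
  shows "larger_elements E = {x \<in> elements_of_size E 2. mate E x < x}"
proof -
  have "sym E"
    using assms by (simp add: one_two_structure_def equiv_def)
  then have "larger_elements E = {s. \<exists>y<s. (s, y) \<in> E}"
    unfolding larger_elements_def by (auto dest: symD)
  then show ?thesis
    by (auto simp: related_iff[OF assms])
qed

lemma infinite_elements_of_size:
  assumes "infinite {c \<in> UNIV // E. card c = k}" "k > 0"
  shows "infinite (elements_of_size E k)"
proof
  assume "finite (elements_of_size E k)"
  moreover have "{c \<in> UNIV // E. card c = k} \<subseteq> (\<lambda>x. E `` {x}) ` elements_of_size E k"
    using assms(2) by (auto simp: quotient_def elements_of_size_def card_gt_0_iff)
  ultimately show False
    using assms(1) finite_surj by blast
qed

text \<open>
  A class of size 2 has a larger element, so each of its members is either a larger element or the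
  mate of one; finitely many larger elements would leave only finitely many such members.
\<close>

lemma infinite_larger_elements:
  assumes "one_two_structure E"
  shows "infinite (larger_elements E)"
proof
  assume fin: "finite (larger_elements E)"
  have "elements_of_size E 2 \<subseteq> larger_elements E \<union> mate E ` larger_elements E"
  proof
    fix x assume x: "x \<in> elements_of_size E 2"
    note m = mate_elements_of_size_2[OF assms x]
    show "x \<in> larger_elements E \<union> mate E ` larger_elements E"
    proof (cases "mate E x < x")
      case True
      then show ?thesis
        using x by (simp add: larger_elements_eq[OF assms])
    next
      case False
      then have "mate E x \<in> larger_elements E"
        using m by (simp add: larger_elements_eq[OF assms])
      then show ?thesis
        using m(3) by (metis UnCI imageI)
    qed
  qed
  then have "finite (elements_of_size E 2)"
    using fin by (meson finite_UnI finite_imageI finite_subset)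
  moreover have "infinite (elements_of_size E 2)"
    using assms by (intro infinite_elements_of_size) (auto simp: one_two_structure_def)
  ultimately show False
    by simp
qed

text \<open>
  The set of all elements of size 2 is in general only semidecidable: the second element may appear
  arbitrarily late. For the larger element of a class the search is bounded by the element itself.
\<close>

lemma computable_larger_elements:
  assumes "computable_rel E"
  shows "computable_set (larger_elements E)"
  unfolding computable_set_iff_decidable larger_elements_def mem_Collect_eq
  by (intro computability_intros assms) auto

definition match_pairs :: "nat rel \<Rightarrow> nat rel \<Rightarrow> nat \<Rightarrow> nat" where
  "match_pairs A B x =
     (if mate A x < x then same_rank (larger_elements A) (larger_elements B) x
      else mate B (same_rank (larger_elements A) (larger_elements B) (mate A x)))"

lemma match_pairs:
  assumes A: "one_two_structure A" and B: "one_two_structure B"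
    and x: "x \<in> elements_of_size A 2"
  shows "match_pairs A B x \<in> elements_of_size B 2"
    and "match_pairs B A (match_pairs A B x) = x"
    and "match_pairs A B (mate A x) = mate B (match_pairs A B x)"
proof -
  let ?h = "same_rank (larger_elements A) (larger_elements B)"
  note inf = infinite_larger_elements[OF A] infinite_larger_elements[OF B]
  note m = mate_elements_of_size_2[OF A x]
  have h: "?h z \<in> elements_of_size B 2" "mate B (?h z) < ?h z" for z
    using same_rank(1)[OF inf(2)] by (auto simp: larger_elements_eq[OF B])
  note hm = mate_elements_of_size_2[OF B h(1)]
  have x_or_mate: "mate A x < x \<and> x \<in> larger_elements A \<or> x < mate A x \<and> mate A x \<in> larger_elements A"
    using x m by (auto simp: larger_elements_eq[OF A])
  show "match_pairs A B x \<in> elements_of_size B 2"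
    by (simp add: match_pairs_def h hm)
  show "match_pairs B A (match_pairs A B x) = x"
    using x_or_mate
  proof (elim disjE conjE)
    assume "mate A x < x" "x \<in> larger_elements A"
    then show ?thesis
      using h(2) same_rank_same_rank[OF inf] by (simp add: match_pairs_def)
  next
    assume less: "x < mate A x" and larger: "mate A x \<in> larger_elements A"
    have "\<not> ?h (mate A x) < mate B (?h (mate A x))"
      using h(2) by (rule less_not_sym)
    then show ?thesis
      using less hm m same_rank_same_rank[OF inf larger] by (simp add: match_pairs_def)
  qed
  show "match_pairs A B (mate A x) = mate B (match_pairs A B x)"
    using x_or_mate hm m by (auto simp: match_pairs_def)
qed

lemma bij_betw_match_pairs:
  assumes "one_two_structure A" "one_two_structure B"
  shows "bij_betw (match_pairs A B) (elements_of_size A 2) (elements_of_size B 2)"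
  by (rule bij_betw_byWitness[where f' = "match_pairs B A"])
    (auto simp: assms match_pairs)

text \<open>
  No effectivity is asked of the isomorphism on the elements of size 1, so any bijection between
  these infinite sets will do; the one that preserves ranks is at hand.
\<close>

lemma isomorphism_extending_match_pairs:
  assumes A: "one_two_structure A" and B: "one_two_structure B"
  obtains f where "structure_isomorphism A B f"
    and "\<And>x. x \<in> elements_of_size A 2 \<Longrightarrow> f x = match_pairs A B x"
proof -
  let ?A1 = "elements_of_size A 1" and ?A2 = "elements_of_size A 2"
    and ?B1 = "elements_of_size B 1" and ?B2 = "elements_of_size B 2"
  define f where
    "f x = (if x \<in> ?A2 then match_pairs A B x else same_rank ?A1 ?B1 x)" for x
  have inf: "infinite ?A1" "infinite ?B1"
    using infinite_elements_of_size[of A 1] infinite_elements_of_size[of B 1] A B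
    by (simp_all add: one_two_structure_def)
  have A1: "?A1 = - ?A2" and B1: "?B1 = - ?B2"
    by (rule elements_of_size_1_eq, fact)+
  have "bij_betw f ?A2 ?B2 \<longleftrightarrow> bij_betw (match_pairs A B) ?A2 ?B2"
    by (rule bij_betw_cong) (simp add: f_def)
  moreover have "bij_betw f ?A1 ?B1 \<longleftrightarrow> bij_betw (same_rank ?A1 ?B1) ?A1 ?B1"
    by (rule bij_betw_cong) (simp add: f_def A1 del: One_nat_def)
  ultimately have f2: "bij_betw f ?A2 ?B2" and "bij_betw f ?A1 ?B1"
    using bij_betw_match_pairs[OF A B] bij_betw_same_rank[OF inf] by simp_all
  then have "bij_betw f (?A2 \<union> ?A1) (?B2 \<union> ?B1)"
    by (rule bij_betw_combine) (simp add: B1 del: One_nat_def)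
  then have bij: "bij f"
    by (simp add: A1 B1 del: One_nat_def)
  have f_size: "f x \<in> ?B2 \<longleftrightarrow> x \<in> ?A2" for x
    using f2 bij by (metis bij_betw_def bij_is_inj inj_image_mem_iff)
  have f_mate: "f (mate A x) = mate B (f x)" if "x \<in> ?A2" for x
    using that mate_elements_of_size_2[OF A that] match_pairs[OF A B that] by (simp add: f_def)
  \<comment> \<open>Each relation is determined by its elements of size 2 and their mates, both of which
    \<open>f\<close> preserves.\<close>
  have "(f x, f y) \<in> B \<longleftrightarrow> f y = f x \<or> (x \<in> ?A2 \<and> f y = f (mate A x))" for x y
    using f_size f_mate by (auto simp: related_iff[OF B])
  then have "(f x, f y) \<in> B \<longleftrightarrow> (x, y) \<in> A" for x y
    using bij by (simp add: related_iff[OF A] bij_is_inj inj_eq)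
  then have "structure_isomorphism A B f"
    using bij by (simp add: structure_isomorphism_def)
  then show ?thesis
    by (rule that) (simp add: f_def)
qed

text \<open>
  Only the mate of \<open>x\<close> in the first structure needs an unbounded search that may fail. All
  other ingredients are total: the ranks are computed in the decidable sets of larger elements,
  and the mate of a larger element \<open>t\<close> is the least element of its class.
\<close>

lemma partial_computable_match_pairs:
  assumes A: "one_two_structure A" and B: "one_two_structure B"
    and rA: "computable_rel A" and rB: "computable_rel B"
  shows "partial_computable
    (\<lambda>x. if x \<in> elements_of_size A 2 then Some (match_pairs A B x) else None)"
proof -
  let ?h = "same_rank (larger_elements A) (larger_elements B)"
  define least_related where "least_related t = (LEAST u. (u, t) \<in> B)" for t
  have refl: "(t, t) \<in> B" for t
    using related_iff[OF B] by simp
  have least_related_eq: "least_related t = mate B t" if "t \<in> larger_elements B" for t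
  proof -
    have t: "t \<in> elements_of_size B 2" "mate B t < t"
      using that by (simp_all add: larger_elements_eq[OF B])
    have "(u, t) \<in> B \<longleftrightarrow> u = t \<or> u = mate B t" for u
      using t(1) mate_elements_of_size_2[OF B] related_iff[OF B] by metis
    then show ?thesis
      unfolding least_related_def using t(2) by (auto intro!: Least_equality)
  qed
  define F where "F x y = (if y < x then ?h x else least_related (?h y))" for x y
  have rec_h: "recursive n (\<lambda>xs. ?h (f xs))" if "recursive n f" for n f
    by (intro recursive_same_rank computable_larger_elements infinite_larger_elements that A B rA rB)
  have rec_least: "recursive 1 (\<lambda>xs. least_related (xs ! 0))"
    unfolding least_related_def using refl
    by (intro recursive_Least computability_intros rB) auto
  have "partial_computable (\<lambda>x. if \<exists>y. y \<noteq> x \<and> (x, y) \<in> A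
      then Some (F x (mate A x)) else None)"
    unfolding mate_def
  proof (rule partial_computable_search)
    show "decidable 2 (\<lambda>zs. zs ! 0 \<noteq> zs ! 1 \<and> (zs ! 1, zs ! 0) \<in> A)"
      by (intro computability_intros rA) auto
    show "recursive 2 (\<lambda>zs. F (zs ! 0) (zs ! 1))"
      unfolding F_def
      by (intro computability_intros rec_h recursive_compose1[OF rec_least]) auto
  qed
  moreover have "F x (mate A x) = match_pairs A B x" for x
    using same_rank(1)[OF infinite_larger_elements[OF B]]
    by (simp add: F_def match_pairs_def least_related_eq)
  ultimately show ?thesis
    by (simp add: mem_elements_of_size_2_iff[OF A] cong: if_cong)
qed

text \<open>
  The domain and range of \<open>\<theta>\<close> are exactly the two sets of elements of size 2, so that both
  density conditions are the hypotheses on these sets.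
\<close>

lemma generically_isomorphic_if_dense_pairs:
  assumes A: "one_two_structure A" "computable_rel A" "has_density (elements_of_size A 2) 1"
    and B: "one_two_structure B" "computable_rel B" "has_density (elements_of_size B 2) 1"
  shows "generically_computably_isomorphic A B"
proof -
  define \<theta> where
    "\<theta> x = (if x \<in> elements_of_size A 2 then Some (match_pairs A B x) else None)" for x
  obtain f where f: "structure_isomorphism A B f"
    "\<And>x. x \<in> elements_of_size A 2 \<Longrightarrow> f x = match_pairs A B x"
    using isomorphism_extending_match_pairs[OF A(1) B(1)] by blast
  have dom: "dom \<theta> = elements_of_size A 2"
    by (auto simp: \<theta>_def dom_def)
  have "ran \<theta> = match_pairs A B ` elements_of_size A 2"
    by (auto simp: \<theta>_def ran_def)
  then have ran: "ran \<theta> = elements_of_size B 2"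
    using bij_betw_match_pairs[OF A(1) B(1)] by (simp add: bij_betw_def)
  have "partial_computable \<theta>"
    using partial_computable_match_pairs[OF A(1) B(1) A(2) B(2)] by (simp add: \<theta>_def[abs_def])
  moreover have "\<forall>x\<in>dom \<theta>. \<theta> x = Some (f x)"
    using f(2) unfolding dom by (simp add: \<theta>_def)
  ultimately show ?thesis
    unfolding generically_computably_isomorphic_def using f(1) A(3) B(3) dom ran by metis
qed

section \<open>A structure whose set of elements of size 2 is computable\<close>

text \<open>
  Through the order isomorphism \<open>rank N\<close> from \<open>N\<close> onto the natural numbers, this is the
  partition of the latter into the pairs \<open>{2k, 2k + 1}\<close>; outside \<open>N\<close> all classes are singletons.
\<close>

definition paired_structure :: "nat set \<Rightarrow> nat rel" where
  "paired_structure N =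
     {(x, y). x = y \<or> (x \<in> N \<and> y \<in> N \<and> rank N x div 2 = rank N y div 2)}"

lemma paired_structure_class:
  "x \<notin> N \<Longrightarrow> paired_structure N `` {x} = {x}"
  by (auto simp: paired_structure_def)

lemma card_paired_structure_class:
  assumes "infinite N" "x \<in> N"
  shows "card (paired_structure N `` {x}) = 2"
proof -
  define k where "k = rank N x div 2"
  note bij = bij_betw_rank[OF assms(1)]
  have "paired_structure N `` {x} = {y \<in> N. rank N y \<in> {2 * k, 2 * k + 1}}"
    using assms(2) unfolding paired_structure_def k_def by auto
  then have "rank N ` (paired_structure N `` {x}) = rank N ` N \<inter> {2 * k, 2 * k + 1}"
    by blast
  then have "rank N ` (paired_structure N `` {x}) = {2 * k, 2 * k + 1}"
    using bij by (simp add: bij_betw_def)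
  moreover have "inj_on (rank N) (paired_structure N `` {x})"
    using bij assms(2) unfolding bij_betw_def
    by (auto simp: paired_structure_def intro: inj_on_subset)
  ultimately show ?thesis
    using card_image by fastforce
qed

lemma elements_of_size_paired_structure:
  assumes "infinite N"
  shows "elements_of_size (paired_structure N) 2 = N"
    and "elements_of_size (paired_structure N) 1 = - N"
proof -
  have *: "finite (paired_structure N `` {x}) \<and>
      card (paired_structure N `` {x}) = (if x \<in> N then 2 else 1)" for x
    using card_paired_structure_class[OF assms, of x] paired_structure_class[of x N]
    by (auto simp: card_ge_0_finite)
  show "elements_of_size (paired_structure N) 2 = N"
    "elements_of_size (paired_structure N) 1 = - N"
    by (auto simp: elements_of_size_def *)
qed

lemma equiv_paired_structure: "equiv UNIV (paired_structure N)"
  by (rule equivI) (auto simp: paired_structure_def refl_on_def sym_def trans_def)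

lemma infinite_classes_if_infinite_elements:
  assumes "infinite (elements_of_size E k)" and E: "equiv UNIV E"
  shows "infinite {c \<in> UNIV // E. card c = k}"
proof
  assume fin: "finite {c \<in> UNIV // E. card c = k}"
  have "elements_of_size E k \<subseteq> \<Union> {c \<in> UNIV // E. card c = k \<and> finite c}"
  proof
    fix x assume "x \<in> elements_of_size E k"
    then have "E `` {x} \<in> {c \<in> UNIV // E. card c = k \<and> finite c}"
      by (simp add: elements_of_size_def quotientI)
    moreover have "x \<in> E `` {x}"
      using equiv_class_self[OF E] by blast
    ultimately show "x \<in> \<Union> {c \<in> UNIV // E. card c = k \<and> finite c}"
      by (rule UnionI)
  qed
  moreover have "finite (\<Union> {c \<in> UNIV // E. card c = k \<and> finite c})"
    by (rule finite_Union) (auto intro: finite_subset[OF _ fin])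
  ultimately show False
    using assms(1) finite_subset by blast
qed

lemma one_two_paired_structure:
  assumes "infinite N" "infinite (- N)"
  shows "one_two_structure (paired_structure N)"
  unfolding one_two_structure_def
proof (intro conjI ballI)
  show "infinite {c \<in> UNIV // paired_structure N. card c = 1}"
    "infinite {c \<in> UNIV // paired_structure N. card c = 2}"
    using assms elements_of_size_paired_structure[OF assms(1)]
    by (simp_all add: infinite_classes_if_infinite_elements equiv_paired_structure)
  show "card c = 1 \<or> card c = 2" if c: "c \<in> UNIV // paired_structure N" for c
  proof -
    obtain x where "c = paired_structure N `` {x}"
      using c by (auto elim: quotientE)
    then show ?thesis
      using card_paired_structure_class[OF assms(1), of x] paired_structure_class[of x N]
      by (cases "x \<in> N") auto
  qed
qed (rule equiv_paired_structure)

lemma computable_paired_structure: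
  assumes "computable_set N"
  shows "computable_rel (paired_structure N)"
proof -
  \<comment> \<open>Equality of halves is expressed through addition and a quantifier bounded by \<open>a\<close>.\<close>
  have half_eq: "a div 2 = b div 2 \<longleftrightarrow>
      (\<exists>k<Suc a. (a = k + k \<or> a = Suc (k + k)) \<and> (b = k + k \<or> b = Suc (k + k)))"
    for a b :: nat
  proof
    assume "a div 2 = b div 2"
    then show "\<exists>k<Suc a. (a = k + k \<or> a = Suc (k + k)) \<and> (b = k + k \<or> b = Suc (k + k))"
      by (intro exI[of _ "a div 2"]) auto
  qed auto
  show ?thesis
    unfolding computable_rel_iff_decidable paired_structure_def mem_Collect_eq prod.case half_eq
    by (intro computability_intros recursive_rank assms) auto
qed

text \<open>The bound on \<open>m\<close> makes decidability an instance of the closure rules.\<close>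

definition nonsquares :: "nat set" where
  "nonsquares = {x. \<not> (\<exists>m<Suc x. x = m * m)}"

lemma compl_nonsquares: "- nonsquares = range (\<lambda>m. m * m)"
proof -
  have "m < Suc (m * m)" for m :: nat
    by (simp add: less_Suc_eq_le)
  then show ?thesis
    by (auto simp: nonsquares_def)
qed

lemma computable_nonsquares: "computable_set nonsquares"
  unfolding computable_set_iff_decidable nonsquares_def mem_Collect_eq
  by (intro computability_intros) auto

lemma infinite_squares: "infinite (- nonsquares)"
proof -
  have "inj (\<lambda>m::nat. m * m)"
    by (auto intro!: injI simp flip: power2_eq_square)
  then show ?thesis
    by (simp add: compl_nonsquares finite_image_iff)
qed

lemma density_one_imp_infinite:
  assumes "has_density S 1"
  shows "infinite S"
proof
  assume fin: "finite S"
  have "(\<lambda>n. real (card S) / real (n + 1)) \<longlonglongrightarrow> 0"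
    by real_asymp
  moreover have "norm (real (card (S \<inter> {0..n})) / real (n + 1)) \<le>
      norm (real (card S) / real (n + 1)) * 1" for n
  proof -
    have "card (S \<inter> {0..n}) \<le> card S"
      using fin by (intro card_mono) auto
    then have "real (card (S \<inter> {0..n})) / real (n + 1) \<le> real (card S) / real (n + 1)"
      by (intro divide_right_mono) simp_all
    then show ?thesis
      by simp
  qed
  ultimately have "(\<lambda>n. real (card (S \<inter> {0..n})) / real (n + 1)) \<longlonglongrightarrow> 0"
    by (rule tendsto_0_le[OF _ always_eventually[OF allI]])
  then have "(0::real) = 1"
    using assms unfolding has_density_def by (rule LIMSEQ_unique)
  then show False
    by simp
qed

text \<open>There are at most \<open>sqrt n + 1\<close> squares up to \<open>n\<close>, and \<open>(sqrt n + 1) / (n + 1)\<close> tends to zero.\<close>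

lemma density_nonsquares: "has_density nonsquares 1"
  unfolding has_density_def
proof (rule tendsto_sandwich)
  show "\<forall>\<^sub>F n in sequentially.
      1 - (sqrt (real n) + 1) / real (n + 1) \<le> real (card (nonsquares \<inter> {0..n})) / real (n + 1)"
  proof (intro always_eventually allI)
    fix n
    have "m \<in> {..nat \<lfloor>sqrt (real n)\<rfloor>}" if "m * m \<le> n" for m
    proof -
      have "real m * real m \<le> real n"
        using that by (metis of_nat_le_iff of_nat_mult)
      then have "real m \<le> sqrt (real n)"
        by (intro real_le_rsqrt) (simp add: power2_eq_square)
      then show ?thesis
        by (simp add: le_nat_iff le_floor_iff)
    qed
    then have "- nonsquares \<inter> {0..n} \<subseteq> (\<lambda>m. m * m) ` {..nat \<lfloor>sqrt (real n)\<rfloor>}"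
      by (auto simp: compl_nonsquares)
    then have "card (- nonsquares \<inter> {0..n}) \<le> nat \<lfloor>sqrt (real n)\<rfloor> + 1"
      using surj_card_le[of "{..nat \<lfloor>sqrt (real n)\<rfloor>}"] by simp
    then have "real (card (- nonsquares \<inter> {0..n})) \<le> sqrt (real n) + 1"
      using of_int_floor_le[of "sqrt (real n)"] real_sqrt_ge_zero[of "real n"] by linarith
    moreover have "card (nonsquares \<inter> {0..n}) + card (- nonsquares \<inter> {0..n}) = n + 1"
      by (subst card_Un_disjoint[symmetric]) (auto simp flip: Int_Un_distrib2)
    ultimately have "real (n + 1) - (sqrt (real n) + 1) \<le> real (card (nonsquares \<inter> {0..n}))"
      by linarith
    then have "(real (n + 1) - (sqrt (real n) + 1)) / real (n + 1) \<le>
        real (card (nonsquares \<inter> {0..n})) / real (n + 1)"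
      by (rule divide_right_mono) simp
    moreover have "1 - y / real (n + 1) = (real (n + 1) - y) / real (n + 1)" for y
      by (simp add: field_simps)
    ultimately show "1 - (sqrt (real n) + 1) / real (n + 1) \<le>
        real (card (nonsquares \<inter> {0..n})) / real (n + 1)"
      by (simp only:)
  qed
  show "\<forall>\<^sub>F n in sequentially. real (card (nonsquares \<inter> {0..n})) / real (n + 1) \<le> 1"
  proof (intro always_eventually allI)
    fix n
    have "card (nonsquares \<inter> {0..n}) \<le> card {0..n}"
      by (intro card_mono) auto
    then show "real (card (nonsquares \<inter> {0..n})) / real (n + 1) \<le> 1"
      by simp
  qed
  show "(\<lambda>n. 1 - (sqrt (real n) + 1) / real (n + 1)) \<longlonglongrightarrow> 1"
    by real_asymp
qed simp

section \<open>Isomorphism with the paired non-squares and with any second structure\<close>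

theorem theorem4p6:
  fixes A B :: "nat rel"
  assumes "computable_equivalence_structure A" and "one_two_structure A"
    and "computable_equivalence_structure B" and "one_two_structure B"
    and "has_generic_character_singleton A 2"
    and "has_generic_character_singleton B 2"
  shows "(\<exists>C. computable_equivalence_structure C \<and>
              computable_set (elements_of_size C 2) \<and>
              generically_computably_isomorphic A C) \<and>
         generically_computably_isomorphic A B"
proof (intro conjI exI)
  let ?C = "paired_structure nonsquares"
  have A: "computable_rel A" "has_density (elements_of_size A 2) 1"
    and B: "computable_rel B" "has_density (elements_of_size B 2) 1"
    using assms by (auto simp: computable_equivalence_structure_def
        has_generic_character_singleton_def)
  have inf: "infinite nonsquares"
    using density_nonsquares by (rule density_one_imp_infinite)
  have size: "elements_of_size ?C 2 = nonsquares"
    by (rule elements_of_size_paired_structure(1)[OF inf])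
  have C: "computable_rel ?C"
    by (rule computable_paired_structure[OF computable_nonsquares])
  then show "computable_equivalence_structure ?C"
    by (simp add: computable_equivalence_structure_def equiv_paired_structure)
  show "computable_set (elements_of_size ?C 2)"
    unfolding size by (rule computable_nonsquares)
  show "generically_computably_isomorphic A ?C"
    using assms(2) A one_two_paired_structure[OF inf infinite_squares] C density_nonsquares
    by (intro generically_isomorphic_if_dense_pairs) (simp_all add: size)
  show "generically_computably_isomorphic A B"
    using assms(2,4) A B by (intro generically_isomorphic_if_dense_pairs)
qed

end
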